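(* Suppose $R_0\neq\alpha_1$. Let $x_e$ be the threshold value given by $x_e=0$ if $R_0<\alpha_1$; $x_e=m$ if $\alpha_m\le R_0\le\beta_m$ for some $m\in\{1,2,\ldots\}$; and $x_e=\chi_m$ if $\beta_m<R_0<\alpha_{m+1}$ for some $m\in\{1,2,\ldots\}$. Then the threshold strategy with threshold value $x_e$ is an evolutionarily stable strategy (ESS).
   Context: Model (no reneging). Parameters $\lambda,\mu>0$, $0<q<1$, $R_0>0$. Single-server first-come-first-served queue: Poisson arrivals of rate $\lambda$, i.i.d. exponential($\mu$) services. After each service a customer departs successfully with probability $q$, and otherwise immediately rejoins the end of the queue. An arriving customer who sees $j-1$ customers in the system may join, taking position $j$ (position 1 is in service), or balk; once joined she stays until success. Waiting costs 1 per unit time, and success gives reward $R_0$; balking gives payoff $0$. Threshold strategy: for $x\ge 0$, with $n=\lfloor x\rfloor$ and $p=x-n$, a customer using threshold $x$ joins at position $i$ with probability $u^{(x)}(i)$, where $u^{(x)}(i)=1$ if $i\le n$, $u^{(x)}(n+1)=p$, and $u^{(x)}(i)=0$ if $i\ge n+2$. For $1\le i\le j\le\lceil x\rceil+1$, $w^{(x)}_{i,j}$ is the expected remaining time until a tagged customer departs when she is in position $i$, there are $j$ customers in the system and all other customers use threshold $x$. Equivalently, $(w^{(x)}_{i,j})$ is the unique solution of $$(\lambda+\mu)w_{i,j}=1+\lambda\left[u^{(x)}(j+1)w_{i,j+1}+(1-u^{(x)}(j+1))w_{i,j}\right]+\mu\, s_{i,j},$$ where $s_{1,j}=(1-q)w_{j,j}$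 and $s_{i,j}=q\,w_{i-1,j-1}+(1-q)\,w_{i-1,j}$ for $i>1$ (terms with zero coefficient are omitted). Put $z^{(x)}_{i,j}=R_0-w^{(x)}_{i,j}$. For $m\ge1$: $\alpha_m=w^{(m)}_{m,m}$, $\beta_m=w^{(m)}_{m+1,m+1}$, and when $\beta_m<R_0<\alpha_{m+1}$, $\chi_m\in(m,m+1)$ is the unique solution of $w^{(\chi_m)}_{m+1,m+1}=R_0$. Let $\pi^{(x)}_j$, $0\le j\le\lceil x\rceil$, be the stationary distribution of the number of customers in the system when everyone uses threshold $x$ (birth-death chain with birth rate $\lambda u^{(x)}(j+1)$ in state $j$ and death rate $\mu q$ in states $j\ge1$). The total expected payoff of a tagged customer using threshold $x$ when all others use $x'$ is $$U(x,x')=\sum_{i=1}^{\lfloor x\rfloor\wedge(\lceil x'\rceil+1)}\pi^{(x')}_{i-1}z^{(x')}_{i,i}+(x-\lfloor x\rfloor)\,\pi^{(x')}_{\lfloor x\rfloor}\,z^{(x')}_{\lfloor x\rfloor+1,\lfloor x\rfloor+1}\mathbf 1_{\{\lfloor x\rfloor<\lceil x'\rceil+1\}}.$$ ESS: a Nash equilibrium threshold $x$ (i.e. $U(x,x)\ge U(x',x)$ for all thresholds $x'\ge0$) is an ESS if for every threshold $x'\ne x$, either $U(x,x)>U(x',x)$, or $U(x,x)=U(x',x)$ and $U(x,x')>U(x',x')$. *)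

theory Defs
  imports Complex_Main
begin

text \<open>
  Parameters, in this order: arrival rate \<open>lam\<close>, service rate \<open>mu\<close>, success probability \<open>q\<close>
  of a service, reward \<open>R0\<close>. A threshold is a real number \<open>x \<ge> 0\<close>; positions \<open>i\<close> and numbers of
  customers \<open>j\<close> are natural numbers.
\<close>

definition join_prob :: "real \<Rightarrow> nat \<Rightarrow> real" where
  "join_prob x i =
     (if int i \<le> \<lfloor>x\<rfloor> then 1 else if int i = \<lfloor>x\<rfloor> + 1 then x - of_int \<lfloor>x\<rfloor> else 0)"

definition after_service :: "real \<Rightarrow> (nat \<Rightarrow> nat \<Rightarrow> real) \<Rightarrow> nat \<Rightarrow> nat \<Rightarrow> real" where
  "after_service q w i j =
     (if i = 1 then (1 - q) * w j j else q * w (i - 1) (j - 1) + (1 - q) * w (i - 1) j)"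

definition wait_indices :: "real \<Rightarrow> (nat \<times> nat) set" where
  "wait_indices x = {(i, j). 1 \<le> i \<and> i \<le> j \<and> int j \<le> \<lceil>x\<rceil> + 1}"

text \<open>
  First-step equations for the expected remaining times. The value 0 outside the index set only
  makes the solution unique as a total function: for \<open>j = \<lceil>x\<rceil> + 1\<close> the term \<open>w i (j + 1)\<close>
  has coefficient 0, and all other terms stay inside the index set.
\<close>

definition solves_wait_equations ::
    "real \<Rightarrow> real \<Rightarrow> real \<Rightarrow> real \<Rightarrow> (nat \<Rightarrow> nat \<Rightarrow> real) \<Rightarrow> bool" where
  "solves_wait_equations lam mu q x w \<longleftrightarrow>
     (\<forall>(i, j) \<in> wait_indices x.
        (lam + mu) * w i j =
          1 + lam * (join_prob x (j + 1) * w i (j + 1) + (1 - join_prob x (j + 1)) * w i j)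
            + mu * after_service q w i j) \<and>
     (\<forall>i j. (i, j) \<notin> wait_indices x \<longrightarrow> w i j = 0)"

definition wait :: "real \<Rightarrow> real \<Rightarrow> real \<Rightarrow> real \<Rightarrow> nat \<Rightarrow> nat \<Rightarrow> real" where
  "wait lam mu q x = (THE w. solves_wait_equations lam mu q x w)"

definition net_payoff ::
    "real \<Rightarrow> real \<Rightarrow> real \<Rightarrow> real \<Rightarrow> real \<Rightarrow> nat \<Rightarrow> nat \<Rightarrow> real" where
  "net_payoff lam mu q R0 x i j = R0 - wait lam mu q x i j"

definition alpha :: "real \<Rightarrow> real \<Rightarrow> real \<Rightarrow> nat \<Rightarrow> real" where
  "alpha lam mu q m = wait lam mu q (real m) m m"

definition beta :: "real \<Rightarrow> real \<Rightarrow> real \<Rightarrow> nat \<Rightarrow> real" where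
  "beta lam mu q m = wait lam mu q (real m) (m + 1) (m + 1)"

definition chi :: "real \<Rightarrow> real \<Rightarrow> real \<Rightarrow> real \<Rightarrow> nat \<Rightarrow> real" where
  "chi lam mu q R0 m =
     (THE x. real m < x \<and> x < real (m + 1) \<and> wait lam mu q x (m + 1) (m + 1) = R0)"

text \<open>
  The stationary distribution, given by normalization and the global balance equations of the
  birth-death chain on \<open>{0..\<lceil>x\<rceil>}\<close>, and extended by 0 to all natural numbers.
\<close>

definition birth_rate :: "real \<Rightarrow> real \<Rightarrow> nat \<Rightarrow> real" where
  "birth_rate lam x j = lam * join_prob x (j + 1)"

definition death_rate :: "real \<Rightarrow> real \<Rightarrow> nat \<Rightarrow> real" where
  "death_rate mu q j = (if j = 0 then 0 else mu * q)"

definition is_stationary ::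
    "real \<Rightarrow> real \<Rightarrow> real \<Rightarrow> real \<Rightarrow> (nat \<Rightarrow> real) \<Rightarrow> bool" where
  "is_stationary lam mu q x p \<longleftrightarrow>
     (\<forall>j. 0 \<le> p j) \<and> (\<forall>j > nat \<lceil>x\<rceil>. p j = 0) \<and> (\<Sum>j \<le> nat \<lceil>x\<rceil>. p j) = 1 \<and>
     (\<forall>j \<le> nat \<lceil>x\<rceil>.
        (birth_rate lam x j + death_rate mu q j) * p j =
          (if j = 0 then 0 else birth_rate lam x (j - 1) * p (j - 1))
            + death_rate mu q (j + 1) * p (j + 1))"

definition stationary :: "real \<Rightarrow> real \<Rightarrow> real \<Rightarrow> real \<Rightarrow> nat \<Rightarrow> real" where
  "stationary lam mu q x = (THE p. is_stationary lam mu q x p)"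

text \<open>Expected payoff of a customer using threshold \<open>x\<close> when all others use \<open>x'\<close>.\<close>

definition payoff :: "real \<Rightarrow> real \<Rightarrow> real \<Rightarrow> real \<Rightarrow> real \<Rightarrow> real \<Rightarrow> real" where
  "payoff lam mu q R0 x x' =
     (let n = nat \<lfloor>x\<rfloor>; N = nat \<lceil>x'\<rceil> + 1 in
        (\<Sum>i = 1..min n N. stationary lam mu q x' (i - 1) * net_payoff lam mu q R0 x' i i)
        + (x - real n) * stationary lam mu q x' n * net_payoff lam mu q R0 x' (n + 1) (n + 1)
            * of_bool (n < N))"

definition is_Nash :: "real \<Rightarrow> real \<Rightarrow> real \<Rightarrow> real \<Rightarrow> real \<Rightarrow> bool" where
  "is_Nash lam mu q R0 x \<longleftrightarrow>
     0 \<le> x \<and> (\<forall>x' \<ge> 0. payoff lam mu q R0 x x \<ge> payoff lam mu q R0 x' x)"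

definition is_ESS :: "real \<Rightarrow> real \<Rightarrow> real \<Rightarrow> real \<Rightarrow> real \<Rightarrow> bool" where
  "is_ESS lam mu q R0 x \<longleftrightarrow>
     is_Nash lam mu q R0 x \<and>
     (\<forall>x' \<ge> 0. x' \<noteq> x \<longrightarrow>
        payoff lam mu q R0 x x > payoff lam mu q R0 x' x \<or>
        (payoff lam mu q R0 x x = payoff lam mu q R0 x' x \<and>
         payoff lam mu q R0 x x' > payoff lam mu q R0 x' x'))"

text \<open>
  The definite description makes it part of any claim about \<open>threshold_e\<close> that the cases cover
  \<open>R0\<close> and determine a single value.
\<close>

definition threshold_e :: "real \<Rightarrow> real \<Rightarrow> real \<Rightarrow> real \<Rightarrow> real" where
  "threshold_e lam mu q R0 =
     (THE x.
        (R0 < alpha lam mu q 1 \<and> x = 0) \<or>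
        (\<exists>m \<ge> 1. alpha lam mu q m \<le> R0 \<and> R0 \<le> beta lam mu q m \<and> x = real m) \<or>
        (\<exists>m \<ge> 1. beta lam mu q m < R0 \<and> R0 < alpha lam mu q (m + 1) \<and> x = chi lam mu q R0 m))"

end

theory Submission
  imports Defs
begin

text \<open>
  A customer who joins at position \<open>i\<close> is the last of \<open>i\<close> customers, so
  her decision only involves the diagonal times \<open>w i i\<close>, and the payoff against
  threshold \<open>y\<close> is the sum over positions \<open>i\<close> of (probability of joining
  at \<open>i\<close>) times a positive stationary weight times \<open>R0 - w i i\<close>
  (\<open>payoff_eq_sum\<close>). Two monotonicity facts then decide everything:
  \<open>w i i\<close> is strictly increasing in \<open>i\<close>, so a best reply joins up to a
  cut-off position, and for \<open>k \<ge> 2\<close> the time \<open>w k k\<close> strictly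
  increases when the others raise their probability of joining at \<open>k\<close> (avoid the
  crowd). At \<open>threshold_e\<close> the cut-off is consistent with the threshold itself. Another
  threshold \<open>y\<close> is an equally good reply only if the customer is indifferent at a
  position where the two differ; if everyone used \<open>y\<close>, the time at that position would
  move strictly away from \<open>R0\<close> in the direction that punishes \<open>y\<close>.
  Position 1 is exceptional, since with thresholds in \<open>[0, 1]\<close> the time there does not
  depend on the others. Indifference at position 1 between such thresholds means
  \<open>R0 = alpha 1\<close>, which is excluded.

  The order properties come from value iteration. The first-step equations are the fixed-point
  equations of a monotone operator, and the expected times are the limit of its iterates from 0.
  Monotonicity of \<open>w\<close> in the position does not reproduce itself under the operator:
  comparing positions 1 and 2 requires the inequality
  \<open>(1 - q) * w (j + 1) (j + 1) \<le> q * w 1 j + (1 - q) * w 1 (j + 1)\<close>. Together with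
  monotonicity in the position and in the queue length this inequality does form an invariant,
  provided that the join probabilities decrease with the position
  (\<open>queue_ordered_step\<close>). Strictness follows from the fixed-point equations: one
  position further costs at least one more service (\<open>sojourn_diag_Suc\<close>), and an
  additional arrival delays everyone who may have to rejoin
  (\<open>sojourn_strict_length_first\<close>), which carries over to the join probabilities in
  \<open>sojourn_strict_mono_join\<close>.
\<close>

section \<open>The first-step operator\<close>

text \<open>
  The shape of the join probabilities of a threshold strategy. It is convenient to allow all
  functions of this shape, and states with arbitrarily many customers: different strategies then
  share one state space, and no index set depends on the threshold. Finite support keeps the
  expected times finite.
\<close>

definition admissible :: "(nat \<Rightarrow> real) \<Rightarrow> bool" where
  "admissible u \<longleftrightarrow>
     (\<forall>j. 0 \<le> u j \<and> u j \<le> 1) \<and> (\<forall>j. u (Suc j) \<le> u j) \<and> (\<exists>N. \<forall>j > N. u j = 0)"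

locale feedback_queue =
  fixes lam mu q :: real
  assumes lam_pos: "0 < lam" and mu_pos: "0 < mu" and q_pos: "0 < q" and q_less_1: "q < 1"
begin

text \<open>
  The linear part of the first-step equations, that is, the expected value after the next event
  multiplied by the total event rate \<open>lam + mu\<close>.
\<close>

definition jump :: "(nat \<Rightarrow> real) \<Rightarrow> (nat \<Rightarrow> nat \<Rightarrow> real) \<Rightarrow> nat \<Rightarrow> nat \<Rightarrow> real" where
  "jump u w i j =
     lam * (u (Suc j) * w i (Suc j) + (1 - u (Suc j)) * w i j) + mu * after_service q w i j"

definition step :: "(nat \<Rightarrow> real) \<Rightarrow> (nat \<Rightarrow> nat \<Rightarrow> real) \<Rightarrow> nat \<Rightarrow> nat \<Rightarrow> real" where
  "step u w i j = (1 + jump u w i j) / (lam + mu)"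

text \<open>
  The expected part of the remaining time that falls in the first \<open>n\<close> steps of the
  uniformised chain.
\<close>

primrec truncated_sojourn :: "(nat \<Rightarrow> real) \<Rightarrow> nat \<Rightarrow> nat \<Rightarrow> nat \<Rightarrow> real" where
  "truncated_sojourn u 0 = (\<lambda>i j. 0)"
| "truncated_sojourn u (Suc n) = step u (truncated_sojourn u n)"

definition sojourn :: "(nat \<Rightarrow> real) \<Rightarrow> nat \<Rightarrow> nat \<Rightarrow> real" where
  "sojourn u i j = lim (\<lambda>n. truncated_sojourn u n i j)"

lemma step_eq: "(lam + mu) * step u w i j = 1 + jump u w i j"
  using lam_pos mu_pos by (simp add: step_def)

lemma jump_linear:
  "jump u (\<lambda>i j. a * v i j + b * w i j) i j = a * jump u v i j + b * jump u w i j"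
  by (simp add: jump_def after_service_def algebra_simps)

lemma after_service_0 [simp]: "after_service q (\<lambda>_ _. 0) i j = 0"
  by (simp add: after_service_def)

lemma after_service_mono:
  assumes "\<And>i' j'. \<lbrakk>1 \<le> i'; i' \<le> j'; j' \<le> j\<rbrakk> \<Longrightarrow> v i' j' \<le> w i' j'"
    and "1 \<le> i" "i \<le> j"
  shows "after_service q v i j \<le> after_service q w i j"
proof (cases "i = 1")
  case True
  then show ?thesis using assms q_less_1 by (simp add: after_service_def)
next
  case False
  then have "v (i - 1) (j - 1) \<le> w (i - 1) (j - 1)" "v (i - 1) j \<le> w (i - 1) j"
    using assms by auto
  then show ?thesis using False q_pos q_less_1
    by (auto simp: after_service_def intro!: add_mono mult_left_mono)
qed

text \<open>
  For length \<open>j + 1\<close> the comparison of \<open>v\<close> and \<open>w\<close> is only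
  required if an arrival may join. This makes the lemma usable on the finite state space of a
  threshold strategy, which is closed under the transitions of positive probability.
\<close>

lemma jump_mono:
  assumes "\<And>i' j'. \<lbrakk>1 \<le> i'; i' \<le> j'; j' \<le> j \<or> j' = Suc j \<and> u j' \<noteq> 0\<rbrakk> \<Longrightarrow> v i' j' \<le> w i' j'"
    and "1 \<le> i" "i \<le> j" "0 \<le> u (Suc j)" "u (Suc j) \<le> 1"
  shows "jump u v i j \<le> jump u w i j"
proof -
  have "u (Suc j) * v i (Suc j) \<le> u (Suc j) * w i (Suc j)"
    using assms by (cases "u (Suc j) = 0") (auto intro!: mult_left_mono)
  moreover have "(1 - u (Suc j)) * v i j \<le> (1 - u (Suc j)) * w i j"
    using assms by (auto intro!: mult_left_mono)
  moreover have "after_service q v i j \<le> after_service q w i j"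
    using assms by (intro after_service_mono) auto
  ultimately show ?thesis
    using lam_pos mu_pos unfolding jump_def
    by (intro add_mono[OF mult_left_mono[OF add_mono] mult_left_mono]) auto
qed

lemma step_mono:
  assumes "admissible u" "\<And>i j. \<lbrakk>1 \<le> i; i \<le> j\<rbrakk> \<Longrightarrow> v i j \<le> w i j" "1 \<le> i" "i \<le> j"
  shows "step u v i j \<le> step u w i j"
  using assms lam_pos mu_pos unfolding step_def admissible_def
  by (intro divide_right_mono add_left_mono jump_mono) auto


section \<open>The expected remaining times\<close>

lemma truncated_sojourn_Suc:
  assumes "admissible u" "1 \<le> i" "i \<le> j"
  shows "truncated_sojourn u n i j \<le> truncated_sojourn u (Suc n) i j"
  using assms(2,3)
proof (induction n arbitrary: i j)
  case 0
  then show ?case using lam_pos mu_pos by (simp add: step_def jump_def after_service_def)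
next
  case (Suc n)
  then show ?case
    using step_mono[OF assms(1), of "truncated_sojourn u n" "truncated_sojourn u (Suc n)"] by simp
qed

text \<open>
  The bound is a supersolution of the first-step equations: \<open>i / mu\<close> is the time to be
  served once, and the second term pays for the further rounds. The number of rounds after the first
  has mean \<open>(1 - q) / q\<close>, and each takes at most \<open>max j N / mu\<close>, since no
  one joins beyond \<open>N\<close>.
\<close>

lemma truncated_sojourn_bounded:
  assumes "admissible u" and N: "\<forall>j > N. u j = 0" and "1 \<le> i" "i \<le> j"
  shows "truncated_sojourn u n i j \<le> real i / mu + (1 - q) / (mu * q) * real (max j N)"
  using assms(3,4)
proof (induction n arbitrary: i j)
  case 0
  then show ?case using mu_pos q_pos q_less_1 by simp
next
  case (Suc n)
  define V where "V = (\<lambda>i j. real i / mu + (1 - q) / (mu * q) * real (max j N))"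
  have "step u (truncated_sojourn u n) i j \<le> step u V i j"
    using assms(1) Suc unfolding V_def by (intro step_mono) auto
  also have "\<dots> \<le> V i j"
  proof -
    have arrival: "u (Suc j) * V i (Suc j) + (1 - u (Suc j)) * V i j = V i j"
    proof (cases "u (Suc j) = 0")
      case False
      then have "Suc j \<le> N" using N by (meson not_le)
      then have "V i (Suc j) = V i j" unfolding V_def by simp
      then show ?thesis by (simp add: algebra_simps)
    qed simp
    have service: "1 + mu * after_service q V i j \<le> mu * V i j"
    proof (cases "i = 1")
      case True
      define C where "C = (1 - q) / (mu * q) * real (max j N)"
      have "(1 - q) * real j \<le> (1 - q) * real (max j N)"
        using q_less_1 by (intro mult_left_mono) auto
      also have "\<dots> = mu * q * C" unfolding C_def using mu_pos q_pos by simp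
      finally have "1 + (1 - q) * (real j + mu * C) \<le> 1 + mu * C" by (simp add: algebra_simps)
      moreover have "mu * V j j = real j + mu * C" "mu * V 1 j = 1 + mu * C"
        unfolding V_def C_def using mu_pos by (simp_all add: distrib_left)
      moreover have "mu * after_service q V i j = (1 - q) * (mu * V j j)"
        using True by (simp add: after_service_def)
      ultimately show ?thesis using True by simp
    next
      case False
      have "V (i - 1) (j - 1) \<le> V (i - 1) j" unfolding V_def
        using mu_pos q_pos q_less_1 by (intro add_left_mono mult_left_mono) auto
      then have "after_service q V i j \<le> V (i - 1) j"
        using False q_pos by (simp add: after_service_def algebra_simps)
      also have "\<dots> = V i j - 1 / mu"
        using Suc.prems by (simp add: V_def of_nat_diff diff_divide_distrib)
      finally have "mu * after_service q V i j \<le> mu * (V i j - 1 / mu)"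
        using mu_pos by (intro mult_left_mono) auto
      then show ?thesis using mu_pos by (simp add: algebra_simps)
    qed
    have "(lam + mu) * step u V i j \<le> (lam + mu) * V i j"
      unfolding step_eq jump_def arrival using service by (simp add: algebra_simps)
    then show ?thesis using lam_pos mu_pos by simp
  qed
  finally show ?case by (simp add: V_def)
qed

lemma truncated_sojourn_LIMSEQ:
  assumes "admissible u" "1 \<le> i" "i \<le> j"
  shows "(\<lambda>n. truncated_sojourn u n i j) \<longlonglongrightarrow> sojourn u i j"
proof -
  obtain N where "\<forall>j > N. u j = 0" using assms(1) unfolding admissible_def by blast
  then have "\<And>n. truncated_sojourn u n i j \<le> real i / mu + (1 - q) / (mu * q) * real (max j N)"
    using truncated_sojourn_bounded assms by blast
  moreover have "incseq (\<lambda>n. truncated_sojourn u n i j)"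
    using truncated_sojourn_Suc[OF assms] by (intro incseq_SucI)
  ultimately have "convergent (\<lambda>n. truncated_sojourn u n i j)"
    using incseq_convergent by (metis convergent_def)
  then show ?thesis unfolding sojourn_def by (simp add: convergent_LIMSEQ_iff)
qed

lemma truncated_sojourn_le:
  assumes "admissible u" "1 \<le> i" "i \<le> j"
  shows "truncated_sojourn u n i j \<le> sojourn u i j"
  using incseq_le[OF incseq_SucI truncated_sojourn_LIMSEQ[OF assms]] truncated_sojourn_Suc[OF assms]
  by blast

lemma sojourn_eq:
  assumes "admissible u" "1 \<le> i" "i \<le> j"
  shows "(lam + mu) * sojourn u i j = 1 + jump u (sojourn u) i j"
proof -
  note L = truncated_sojourn_LIMSEQ[OF assms(1)]
  have "(\<lambda>n. after_service q (truncated_sojourn u n) i j) \<longlonglongrightarrow> after_service q (sojourn u) i j"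
  proof (cases "i = 1")
    case True
    then show ?thesis using assms unfolding after_service_def
      by (auto intro!: tendsto_intros L)
  next
    case False
    then have "1 \<le> i - 1" "i - 1 \<le> j - 1" "i - 1 \<le> j" using assms by auto
    then show ?thesis using False unfolding after_service_def
      by (auto intro!: tendsto_intros L)
  qed
  moreover have "i \<le> Suc j" using assms by simp
  ultimately have "(\<lambda>n. step u (truncated_sojourn u n) i j) \<longlonglongrightarrow> step u (sojourn u) i j"
    using assms lam_pos mu_pos unfolding step_def jump_def
    by (intro tendsto_intros L) auto
  moreover have "(\<lambda>n. step u (truncated_sojourn u n) i j) \<longlonglongrightarrow> sojourn u i j"
    using LIMSEQ_Suc[OF L[OF assms(2,3)]] by simp
  ultimately have "sojourn u i j = step u (sojourn u) i j"
    using LIMSEQ_unique by blast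
  then show ?thesis using step_eq by metis
qed

lemma sojourn_ge_step_time:
  assumes "admissible u" "1 \<le> i" "i \<le> j"
  shows "1 / (lam + mu) \<le> sojourn u i j"
  using truncated_sojourn_le[OF assms, of 1]
  by (simp add: step_def jump_def)

text \<open>
  A subsolution of the homogeneous equations is at most \<open>K * sojourn\<close> for some
  \<open>K\<close> because \<open>sojourn\<close> is bounded below on the finite state space.
  Applying the operator \<open>n\<close> times improves this to \<open>K\<close> times the expected
  time remaining after \<open>n\<close> steps, which tends to 0.
\<close>

lemma maximum_principle:
  assumes u: "admissible u" "u (Suc M) = 0"
    and sub: "\<And>i j. \<lbrakk>1 \<le> i; i \<le> j; j \<le> M\<rbrakk> \<Longrightarrow> (lam + mu) * d i j \<le> jump u d i j"
    and "1 \<le> i" "i \<le> j" "j \<le> M"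
  shows "d i j \<le> 0"
proof -
  define S where "S = (\<Sum>(i, j) \<in> {..M} \<times> {..M}. \<bar>d i j\<bar>)"
  define K where "K = (lam + mu) * S"
  have S_nonneg: "0 \<le> S" unfolding S_def by (intro sum_nonneg) auto
  have bound: "d i j \<le> K * (sojourn u i j - truncated_sojourn u n i j)"
    if "1 \<le> i" "i \<le> j" "j \<le> M" for i j n
    using that
  proof (induction n arbitrary: i j)
    case 0
    have "\<bar>d i j\<bar> = (\<lambda>(i, j). \<bar>d i j\<bar>) (i, j)" by simp
    also have "\<dots> \<le> S" unfolding S_def using 0 by (intro member_le_sum) auto
    also have "S = K * (1 / (lam + mu))" unfolding K_def using lam_pos mu_pos by simp
    also have "\<dots> \<le> K * sojourn u i j"
      using sojourn_ge_step_time[OF u(1)] 0 S_nonneg lam_pos mu_pos unfolding K_def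
      by (intro mult_left_mono) auto
    finally show ?case by simp
  next
    case (Suc n)
    have "(lam + mu) * d i j \<le> jump u d i j" using sub Suc.prems by blast
    also have "\<dots> \<le> jump u (\<lambda>i j. K * sojourn u i j + (- K) * truncated_sojourn u n i j) i j"
    proof (rule jump_mono)
      fix i' j' assume *: "1 \<le> i'" "i' \<le> j'" "j' \<le> j \<or> j' = Suc j \<and> u j' \<noteq> 0"
      then have "j' \<le> M" using u(2) Suc.prems(3) by (cases "j = M") auto
      then show "d i' j' \<le> K * sojourn u i' j' + (- K) * truncated_sojourn u n i' j'"
        using Suc.IH[OF *(1,2)] by (simp add: algebra_simps)
    qed (use Suc.prems u in \<open>auto simp: admissible_def\<close>)
    also have "\<dots> = K * jump u (sojourn u) i j - K * jump u (truncated_sojourn u n) i j"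
      by (subst jump_linear) simp
    also have "\<dots> = (lam + mu) * (K * (sojourn u i j - truncated_sojourn u (Suc n) i j))"
      using sojourn_eq[OF u(1) Suc.prems(1,2)] step_eq[of u "truncated_sojourn u n" i j]
      by simp algebra
    finally show ?case using lam_pos mu_pos by simp
  qed
  have "(\<lambda>n. K * (sojourn u i j - truncated_sojourn u n i j)) \<longlonglongrightarrow> K * (sojourn u i j - sojourn u i j)"
    using truncated_sojourn_LIMSEQ[OF u(1)] assms by (intro tendsto_intros) auto
  then have "d i j \<le> K * (sojourn u i j - sojourn u i j)"
    using bound[OF assms(4-6)] by (intro LIMSEQ_le_const) auto
  then show ?thesis by simp
qed


section \<open>Monotonicity in the position, in the queue length and in the join probabilities\<close>

text \<open>
  The third condition compares the values after the service of a customer in position 1 and of the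
  customer directly behind her. It is what monotonicity in the position needs at position 1, where
  \<open>after_service\<close> sends the customer to the end of the queue.
\<close>

definition queue_ordered :: "(nat \<Rightarrow> nat \<Rightarrow> real) \<Rightarrow> bool" where
  "queue_ordered w \<longleftrightarrow>
     (\<forall>i j. 1 \<le> i \<and> i \<le> j \<longrightarrow> w i j \<le> w i (Suc j)) \<and>
     (\<forall>i j. 1 \<le> i \<and> i < j \<longrightarrow> w i j \<le> w (Suc i) j) \<and>
     (\<forall>j \<ge> 1. (1 - q) * w (Suc j) (Suc j) \<le> q * w 1 j + (1 - q) * w 1 (Suc j))"

lemma convex_between:
  fixes a b p :: real
  assumes "0 \<le> p" "p \<le> 1" "a \<le> b"
  shows "a \<le> p * b + (1 - p) * a" "p * b + (1 - p) * a \<le> b"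
proof -
  have "p * b + (1 - p) * a = a + p * (b - a)" "p * b + (1 - p) * a = b - (1 - p) * (b - a)"
    by algebra+
  moreover have "0 \<le> p * (b - a)" "0 \<le> (1 - p) * (b - a)" using assms by auto
  ultimately show "a \<le> p * b + (1 - p) * a" "p * b + (1 - p) * a \<le> b" by linarith+
qed

text \<open>
  Monotonicity in the length uses that adding one customer at the end, in front of no one, pushes
  the tagged customer back when she rejoins, so \<open>w j j \<le> w (j + 1) (j + 1)\<close> is
  needed, which is the composition of the first two conditions. Monotonicity in the position uses
  the third condition at position 1. For the third condition, the arrival terms reduce to the same
  condition for lengths \<open>j\<close> and \<open>j + 1\<close> and monotonicity in the position
  once the two join probabilities are equal; here \<open>u (j + 1)\<close> may be lowered to
  \<open>u (j + 2)\<close> because \<open>u\<close> is decreasing. In its service terms everything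
  cancels except \<open>w j (j + 1) \<le> w (j + 1) (j + 1)\<close>, an instance of monotonicity in
  the position.
\<close>

lemma queue_ordered_step:
  assumes u: "admissible u" and w: "queue_ordered w"
  shows "queue_ordered (step u w)"
proof -
  have u01: "0 \<le> u j" "u j \<le> 1" and u_anti: "u (Suc j) \<le> u j" for j
    using u unfolding admissible_def by auto
  have J: "w i j \<le> w i (Suc j)" if "1 \<le> i" "i \<le> j" for i j
    using w that unfolding queue_ordered_def by blast
  have I: "w i j \<le> w (Suc i) j" if "1 \<le> i" "i < j" for i j
    using w that unfolding queue_ordered_def by blast
  have K: "(1 - q) * w (Suc j) (Suc j) \<le> q * w 1 j + (1 - q) * w 1 (Suc j)" if "1 \<le> j" for j
    using w that unfolding queue_ordered_def by blast
  have diag: "w j j \<le> w (Suc j) (Suc j)" if "1 \<le> j" for j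
    using J[of j j] I[of j "Suc j"] that by simp
  have divide: "step u w i j \<le> step u w i' j'" if "jump u w i j \<le> jump u w i' j'" for i j i' j'
    using that lam_pos mu_pos unfolding step_def by (intro divide_right_mono) auto
  have "step u w i j \<le> step u w i (Suc j)" if ij: "1 \<le> i" "i \<le> j" for i j
  proof (rule divide)
    have "u (Suc j) * w i (Suc j) + (1 - u (Suc j)) * w i j \<le> w i (Suc j)"
      using convex_between u01 J ij by blast
    also have "\<dots> \<le> u (Suc (Suc j)) * w i (Suc (Suc j)) + (1 - u (Suc (Suc j))) * w i (Suc j)"
      using convex_between u01 J ij by (meson le_SucI)
    finally have arrival: "u (Suc j) * w i (Suc j) + (1 - u (Suc j)) * w i j
      \<le> u (Suc (Suc j)) * w i (Suc (Suc j)) + (1 - u (Suc (Suc j))) * w i (Suc j)" .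
    have "after_service q w i j \<le> after_service q w i (Suc j)"
    proof (cases "i = 1")
      case True
      then show ?thesis using diag[of j] ij q_less_1 by (simp add: after_service_def)
    next
      case False
      have "w (i - 1) (j - 1) \<le> w (i - 1) j" "w (i - 1) j \<le> w (i - 1) (Suc j)"
        using J[of "i - 1" "j - 1"] J[of "i - 1" j] False ij by auto
      then show ?thesis using False q_pos q_less_1
        by (auto simp: after_service_def intro!: add_mono mult_left_mono)
    qed
    then show "jump u w i j \<le> jump u w i (Suc j)"
      using arrival lam_pos mu_pos unfolding jump_def
      by - (rule add_mono; rule mult_left_mono; simp)
  qed
  moreover have "step u w i j \<le> step u w (Suc i) j" if ij: "1 \<le> i" "i < j" for i j
  proof (rule divide)
    have arrival: "u (Suc j) * w i (Suc j) + (1 - u (Suc j)) * w i j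
      \<le> u (Suc j) * w (Suc i) (Suc j) + (1 - u (Suc j)) * w (Suc i) j"
      using I ij u01 by (intro add_mono mult_left_mono) auto
    have "after_service q w i j \<le> after_service q w (Suc i) j"
    proof (cases "i = 1")
      case True
      then show ?thesis using K[of "j - 1"] ij by (simp add: after_service_def)
    next
      case False
      have "w (i - 1) (j - 1) \<le> w i (j - 1)" "w (i - 1) j \<le> w i j"
        using I[of "i - 1" "j - 1"] I[of "i - 1" j] False ij by auto
      then show ?thesis using False q_pos q_less_1 ij
        by (auto simp: after_service_def intro!: add_mono mult_left_mono)
    qed
    then show "jump u w i j \<le> jump u w (Suc i) j"
      using arrival lam_pos mu_pos unfolding jump_def
      by - (rule add_mono; rule mult_left_mono; simp)
  qed
  moreover have "(1 - q) * step u w (Suc j) (Suc j) \<le> q * step u w 1 j + (1 - q) * step u w 1 (Suc j)"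
    if j: "1 \<le> j" for j
  proof -
    \<comment> \<open>The smaller of the two join probabilities replaces both.\<close>
    define p where "p = u (Suc (Suc j))"
    have p: "0 \<le> p" "p \<le> 1" "p \<le> u (Suc j)" unfolding p_def using u01 u_anti by auto
    have "p * w 1 (Suc j) + (1 - p) * w 1 j \<le> u (Suc j) * w 1 (Suc j) + (1 - u (Suc j)) * w 1 j"
      using mult_nonneg_nonneg[of "u (Suc j) - p" "w 1 (Suc j) - w 1 j"] p(3) J[of 1 j] j
      by (simp add: algebra_simps)
    then have low: "q * (p * w 1 (Suc j) + (1 - p) * w 1 j)
        \<le> q * (u (Suc j) * w 1 (Suc j) + (1 - u (Suc j)) * w 1 j)"
      using q_pos by simp
    have "(1 - q) * w (Suc j) (Suc (Suc j)) \<le> (1 - q) * w (Suc (Suc j)) (Suc (Suc j))"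
      using I[of "Suc j" "Suc (Suc j)"] q_less_1 by simp
    also have "\<dots> \<le> q * w 1 (Suc j) + (1 - q) * w 1 (Suc (Suc j))" using K[of "Suc j"] by simp
    finally have "p * ((1 - q) * w (Suc j) (Suc (Suc j)))
        \<le> p * (q * w 1 (Suc j) + (1 - q) * w 1 (Suc (Suc j)))"
      using p by (intro mult_left_mono) auto
    moreover have "(1 - p) * ((1 - q) * w (Suc j) (Suc j))
        \<le> (1 - p) * (q * w 1 j + (1 - q) * w 1 (Suc j))"
      using K[OF j] p by (intro mult_left_mono) auto
    ultimately have "(1 - q) * (p * w (Suc j) (Suc (Suc j)) + (1 - p) * w (Suc j) (Suc j))
        \<le> q * (p * w 1 (Suc j) + (1 - p) * w 1 j)
          + (1 - q) * (p * w 1 (Suc (Suc j)) + (1 - p) * w 1 (Suc j))"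
      by (simp add: algebra_simps)
    with low have arrival: "lam * ((1 - q) * (p * w (Suc j) (Suc (Suc j)) + (1 - p) * w (Suc j) (Suc j)))
        \<le> lam * (q * (u (Suc j) * w 1 (Suc j) + (1 - u (Suc j)) * w 1 j)
          + (1 - q) * (p * w 1 (Suc (Suc j)) + (1 - p) * w 1 (Suc j)))"
      using lam_pos by (intro mult_left_mono) auto
    have "(1 - q) * ((1 - q) * w j (Suc j)) \<le> (1 - q) * ((1 - q) * w (Suc j) (Suc j))"
      using I[of j "Suc j"] j q_less_1 by (intro mult_left_mono) auto
    then have service: "mu * ((1 - q) * after_service q w (Suc j) (Suc j))
        \<le> mu * (q * after_service q w 1 j + (1 - q) * after_service q w 1 (Suc j))"
      using j mu_pos by (intro mult_left_mono) (auto simp: after_service_def algebra_simps)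
    have "(1 - q) * (1 + jump u w (Suc j) (Suc j))
        \<le> q * (1 + jump u w 1 j) + (1 - q) * (1 + jump u w 1 (Suc j))"
      using arrival service q_pos unfolding jump_def p_def by (simp add: algebra_simps)
    then show ?thesis
      using lam_pos mu_pos
      by (simp add: step_def divide_right_mono flip: add_divide_distrib)
  qed
  ultimately show ?thesis unfolding queue_ordered_def by simp
qed

lemma queue_ordered_truncated_sojourn:
  "admissible u \<Longrightarrow> queue_ordered (truncated_sojourn u n)"
  by (induction n) (simp add: queue_ordered_def, simp add: queue_ordered_step)

lemma sojourn_mono_length:
  assumes "admissible u" "1 \<le> i" "i \<le> j"
  shows "sojourn u i j \<le> sojourn u i (Suc j)"
proof (rule LIMSEQ_le)
  show "(\<lambda>n. truncated_sojourn u n i j) \<longlonglongrightarrow> sojourn u i j"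
    "(\<lambda>n. truncated_sojourn u n i (Suc j)) \<longlonglongrightarrow> sojourn u i (Suc j)"
    using assms by (auto intro!: truncated_sojourn_LIMSEQ)
  show "\<exists>N. \<forall>n\<ge>N. truncated_sojourn u n i j \<le> truncated_sojourn u n i (Suc j)"
    using queue_ordered_truncated_sojourn assms unfolding queue_ordered_def by blast
qed

lemma sojourn_mono_position:
  assumes "admissible u" "1 \<le> i" "i < j"
  shows "sojourn u i j \<le> sojourn u (Suc i) j"
proof (rule LIMSEQ_le)
  show "(\<lambda>n. truncated_sojourn u n i j) \<longlonglongrightarrow> sojourn u i j"
    "(\<lambda>n. truncated_sojourn u n (Suc i) j) \<longlonglongrightarrow> sojourn u (Suc i) j"
    using assms by (auto intro!: truncated_sojourn_LIMSEQ)
  show "\<exists>N. \<forall>n\<ge>N. truncated_sojourn u n i j \<le> truncated_sojourn u n (Suc i) j"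
    using queue_ordered_truncated_sojourn assms unfolding queue_ordered_def by blast
qed

text \<open>
  Arrivals can only lengthen the wait, and one service, which takes \<open>1 / mu\<close> on
  average, turns the last position \<open>j + 1\<close> into position \<open>j\<close> with at least
  \<open>j\<close> customers.
\<close>

lemma sojourn_diag_Suc:
  assumes u: "admissible u" and "1 \<le> j"
  shows "sojourn u j j + 1 / mu \<le> sojourn u (Suc j) (Suc j)"
proof -
  let ?W = "sojourn u"
  have "?W (Suc j) (Suc j) \<le>
      u (Suc (Suc j)) * ?W (Suc j) (Suc (Suc j)) + (1 - u (Suc (Suc j))) * ?W (Suc j) (Suc j)"
    using sojourn_mono_length[OF u] u by (intro convex_between) (auto simp: admissible_def)
  then have "lam * ?W (Suc j) (Suc j) \<le> lam * (u (Suc (Suc j)) * ?W (Suc j) (Suc (Suc j))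
      + (1 - u (Suc (Suc j))) * ?W (Suc j) (Suc j))"
    using lam_pos by simp
  moreover have "?W j j \<le> after_service q ?W (Suc j) (Suc j)"
    using convex_between(1)[of "1 - q" "?W j j" "?W j (Suc j)"] sojourn_mono_length[OF u, of j j]
      assms(2) q_pos q_less_1 by (simp add: after_service_def algebra_simps)
  then have "mu * ?W j j \<le> mu * after_service q ?W (Suc j) (Suc j)" using mu_pos by simp
  ultimately have "1 + mu * ?W j j \<le> mu * ?W (Suc j) (Suc j)"
    using sojourn_eq[OF u, of "Suc j" "Suc j"] unfolding jump_def by (simp add: algebra_simps)
  then show ?thesis using mu_pos by (simp add: field_simps)
qed

lemma sojourn_diag_strict:
  assumes "admissible u" "1 \<le> i" "i < j"
  shows "sojourn u i i < sojourn u j j"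
proof -
  have less_Suc: "sojourn u k k < sojourn u (Suc k) (Suc k)" if "1 \<le> k" for k
  proof -
    have "0 < 1 / mu" using mu_pos by simp
    then show ?thesis using sojourn_diag_Suc[OF assms(1) that] by linarith
  qed
  from assms(3) have "Suc i \<le> j" by simp
  then show ?thesis
  proof (induction j rule: dec_induct)
    case base
    show ?case using less_Suc assms(2) by blast
  next
    case (step n)
    then show ?case using less_Suc[of n] by force
  qed
qed

lemma sojourn_diag_lower_bound:
  assumes "admissible u" "1 \<le> j"
  shows "real j / mu \<le> sojourn u j j + 1 / mu"
  using assms(2)
proof (induction j rule: dec_induct)
  case base
  have "0 \<le> 1 / (lam + mu)" using lam_pos mu_pos by simp
  then have "0 \<le> sojourn u 1 1" using sojourn_ge_step_time[OF assms(1), of 1 1] by linarith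
  then show ?case by simp
next
  case (step n)
  then show ?case using sojourn_diag_Suc[OF assms(1), of n] by (simp add: add_divide_distrib)
qed

text \<open>
  Raising the join probabilities moves weight from \<open>w i j\<close> to
  \<open>w i (j + 1)\<close>, which is at least as large.
\<close>

lemma sojourn_mono_join:
  assumes u: "admissible u" and u': "admissible u'" and le: "\<And>j. u j \<le> u' j"
    and "1 \<le> i" "i \<le> j"
  shows "sojourn u i j \<le> sojourn u' i j"
proof (rule LIMSEQ_le)
  show "(\<lambda>n. truncated_sojourn u n i j) \<longlonglongrightarrow> sojourn u i j"
    "(\<lambda>n. truncated_sojourn u' n i j) \<longlonglongrightarrow> sojourn u' i j"
    using assms by (auto intro!: truncated_sojourn_LIMSEQ)
  have "truncated_sojourn u n i j \<le> truncated_sojourn u' n i j" for n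
    using assms(4,5)
  proof (induction n arbitrary: i j)
    case (Suc n)
    let ?v = "truncated_sojourn u n"
    have "?v i j \<le> ?v i (Suc j)"
      using queue_ordered_truncated_sojourn[OF u] Suc.prems unfolding queue_ordered_def by blast
    then have "0 \<le> lam * ((u' (Suc j) - u (Suc j)) * (?v i (Suc j) - ?v i j))"
      using le lam_pos by simp
    then have "jump u ?v i j \<le> jump u' ?v i j" unfolding jump_def by (simp add: algebra_simps)
    then have "step u ?v i j \<le> step u' ?v i j"
      using lam_pos mu_pos unfolding step_def by (intro divide_right_mono) auto
    also have "\<dots> \<le> step u' (truncated_sojourn u' n) i j"
      using Suc u' by (intro step_mono) auto
    finally show ?case by simp
  qed simp
  then show "\<exists>N. \<forall>n\<ge>N. truncated_sojourn u n i j \<le> truncated_sojourn u' n i j" by blast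
qed

text \<open>
  An unsuccessful customer rejoins at the end, and the end is strictly worse in a longer queue.
\<close>

lemma sojourn_strict_length_first:
  assumes u: "admissible u" and "1 \<le> j"
  shows "sojourn u 1 j < sojourn u 1 (Suc j)"
proof -
  let ?W = "sojourn u"
  have u01: "0 \<le> u j" "u j \<le> 1" for j using u unfolding admissible_def by auto
  have "u (Suc j) * ?W 1 (Suc j) + (1 - u (Suc j)) * ?W 1 j \<le> ?W 1 (Suc j)"
    using sojourn_mono_length[OF u] u01 assms(2) by (intro convex_between) auto
  also have "\<dots> \<le> u (Suc (Suc j)) * ?W 1 (Suc (Suc j)) + (1 - u (Suc (Suc j))) * ?W 1 (Suc j)"
    using sojourn_mono_length[OF u] u01 by (intro convex_between) auto
  finally have "lam * (u (Suc j) * ?W 1 (Suc j) + (1 - u (Suc j)) * ?W 1 j) \<le>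
      lam * (u (Suc (Suc j)) * ?W 1 (Suc (Suc j)) + (1 - u (Suc (Suc j))) * ?W 1 (Suc j))"
    using lam_pos by simp
  moreover have "mu * after_service q ?W 1 j < mu * after_service q ?W 1 (Suc j)"
    using sojourn_diag_strict[OF u, of j "Suc j"] assms(2) mu_pos q_less_1
    by (simp add: after_service_def)
  ultimately have "(lam + mu) * ?W 1 j < (lam + mu) * ?W 1 (Suc j)"
    using sojourn_eq[OF u, of 1 j] sojourn_eq[OF u, of 1 "Suc j"] assms(2)
    unfolding jump_def by simp
  then show ?thesis using lam_pos mu_pos by simp
qed

text \<open>
  The difference \<open>d\<close> of the two times satisfies the first-step equations with a
  nonnegative source in place of the constant 1. The source is positive at
  \<open>(1, k - 1)\<close>, where an arrival joins more often, and positivity propagates to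
  \<open>(k, k)\<close> along services: from \<open>(2, k)\<close> a success of the customer in
  front leads to \<open>(1, k - 1)\<close>, and from \<open>(i + 1, k)\<close> a failure leads to
  \<open>(i, k)\<close>. For \<open>k = 1\<close> there is no state in which an arrival could take
  position \<open>k\<close>.
\<close>

lemma sojourn_strict_mono_join:
  assumes u: "admissible u" and u': "admissible u'" and le: "\<And>j. u j \<le> u' j"
    and k: "2 \<le> k" "u k < u' k"
  shows "sojourn u k k < sojourn u' k k"
proof -
  define d where "d = (\<lambda>i j. 1 * sojourn u' i j + (- 1) * sojourn u i j)"
  have d_nonneg: "0 \<le> d i j" if "1 \<le> i" "i \<le> j" for i j
    using sojourn_mono_join[OF u u' le that] by (simp add: d_def)
  have d_eq: "(lam + mu) * d i j = jump u' d i j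
      + lam * ((u' (Suc j) - u (Suc j)) * (sojourn u i (Suc j) - sojourn u i j))"
    if "1 \<le> i" "i \<le> j" for i j
  proof -
    have "jump u' d i j = jump u' (sojourn u') i j - jump u' (sojourn u) i j"
      unfolding d_def by (subst jump_linear) simp
    moreover have "jump u' (sojourn u) i j - jump u (sojourn u) i j
        = lam * ((u' (Suc j) - u (Suc j)) * (sojourn u i (Suc j) - sojourn u i j))"
      unfolding jump_def by algebra
    ultimately show ?thesis
      using sojourn_eq[OF u that] sojourn_eq[OF u' that] unfolding d_def
      by (simp add: algebra_simps)
  qed
  have source_nonneg:
    "0 \<le> lam * ((u' (Suc j) - u (Suc j)) * (sojourn u i (Suc j) - sojourn u i j))"
    if "1 \<le> i" "i \<le> j" for i j
    using sojourn_mono_length[OF u that] le[of "Suc j"] lam_pos by simp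
  have jump_ge: "mu * after_service q d i j \<le> jump u' d i j" if "1 \<le> i" "i \<le> j" for i j
    using d_nonneg[of i j] d_nonneg[of i "Suc j"] that lam_pos u'
    by (simp add: jump_def admissible_def)
  have service_nonneg: "0 \<le> after_service q d i j" if "1 \<le> i" "i \<le> j" for i j
    using that after_service_mono[of j "\<lambda>_ _. 0" d i] d_nonneg by simp
  have d_pos: "0 < d i j" if "1 \<le> i" "i \<le> j" "0 < after_service q d i j" for i j
  proof -
    have "0 < mu * after_service q d i j" using that mu_pos by simp
    then have "0 < (lam + mu) * d i j"
      using d_eq[OF that(1,2)] jump_ge[OF that(1,2)] source_nonneg[OF that(1,2)] by linarith
    then show ?thesis using lam_pos mu_pos by (simp add: zero_less_mult_iff)
  qed
  obtain j where j: "k = Suc j" "1 \<le> j" using k(1) by (cases k) auto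
  have "0 < lam * ((u' (Suc j) - u (Suc j)) * (sojourn u 1 (Suc j) - sojourn u 1 j))"
    using sojourn_strict_length_first[OF u j(2)] k(2) lam_pos j(1) by simp
  moreover have "0 \<le> mu * after_service q d 1 j" using service_nonneg j mu_pos by simp
  ultimately have "0 < (lam + mu) * d 1 j"
    using d_eq[of 1 j] jump_ge[of 1 j] j by linarith
  then have d1: "0 < d 1 j" using lam_pos mu_pos by (simp add: zero_less_mult_iff)
  have "0 < d i k" if "2 \<le> i" "i \<le> k" for i
    using that
  proof (induction i rule: dec_induct)
    case base
    have "0 < q * d 1 j" "0 \<le> (1 - q) * d 1 k" using d1 q_pos q_less_1 d_nonneg[of 1 k] k by auto
    then have "0 < after_service q d 2 k" using j by (simp add: after_service_def)
    then show ?case using d_pos k by simp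
  next
    case (step i)
    have "0 < (1 - q) * d i k" "0 \<le> q * d i j"
      using step q_pos q_less_1 d_nonneg[of i j] j by auto
    then have "0 < after_service q d (Suc i) k" using j step by (simp add: after_service_def)
    then show ?case using d_pos[of "Suc i" k] step by simp
  qed
  then have "0 < d k k" using k by simp
  then show ?thesis by (simp add: d_def)
qed

text \<open>
  Changing one join probability by at most \<open>e\<close> changes the first-step equations by at
  most \<open>e * (lam * B)\<close>, and \<open>sojourn u'\<close> is the solution for the constant
  source 1. So the difference is at most \<open>e * (lam * B)\<close> times
  \<open>sojourn u'\<close>, by the maximum principle applied to \<open>d\<close>.
\<close>

lemma sojourn_Lipschitz_join:
  assumes u: "admissible u" and u': "admissible u'" and le: "\<And>j. u j \<le> u' j"
    and eps: "0 \<le> e" "u' (Suc m) - u (Suc m) \<le> e" and same: "\<And>j. j \<noteq> Suc m \<Longrightarrow> u' j = u j"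
    and B: "\<And>i. \<lbrakk>1 \<le> i; i \<le> m\<rbrakk> \<Longrightarrow> sojourn u i (Suc m) \<le> B" "0 \<le> B"
    and ij: "1 \<le> i" "i \<le> j"
  shows "sojourn u' i j \<le> sojourn u i j + e * (lam * B * sojourn u' i j)"
proof -
  obtain N where N: "\<forall>j > N. u' j = 0" using u' unfolding admissible_def by blast
  define M where "M = max N j"
  define c where "c = 1 - e * (lam * B)"
  define d where "d = (\<lambda>i j. c * sojourn u' i j + (- 1) * sojourn u i j)"
  have "(lam + mu) * d i j \<le> jump u' d i j" if "1 \<le> i" "i \<le> j" for i j
  proof -
    have "jump u' (sojourn u) i j - jump u (sojourn u) i j
        = lam * ((u' (Suc j) - u (Suc j)) * (sojourn u i (Suc j) - sojourn u i j))"
      unfolding jump_def by algebra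
    also have "\<dots> \<le> e * (lam * B)"
    proof (cases "j = m")
      case True
      have "0 \<le> sojourn u i j" using sojourn_ge_step_time[OF u that] lam_pos mu_pos
        by (meson add_pos_pos less_le_trans less_imp_le zero_less_divide_1_iff)
      then have "sojourn u i (Suc j) - sojourn u i j \<le> B" using B(1)[of i] that True by simp
      then have "(u' (Suc j) - u (Suc j)) * (sojourn u i (Suc j) - sojourn u i j) \<le> e * B"
        using eps True sojourn_mono_length[OF u that] by (intro mult_mono) auto
      then show ?thesis using lam_pos by (simp add: mult.left_commute)
    next
      case False
      then show ?thesis using same[of "Suc j"] eps lam_pos B by simp
    qed
    finally show ?thesis
      using sojourn_eq[OF u that] sojourn_eq[OF u' that]
      unfolding d_def jump_linear c_def by (simp add: algebra_simps) 
  qed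
  then have "d i j \<le> 0"
    using N ij by (intro maximum_principle[OF u', where M = M]) (auto simp: M_def)
  then show ?thesis by (simp add: d_def c_def algebra_simps)
qed

end


section \<open>Threshold strategies\<close>

text \<open>
  In this form monotonicity in the threshold and in the position is visible without floors.
\<close>

lemma join_prob_eq: "join_prob x i = max 0 (min 1 (x - real i + 1))"
proof -
  have floor: "of_int \<lfloor>x\<rfloor> \<le> x" "x < of_int \<lfloor>x\<rfloor> + 1" by linarith+
  consider "int i \<le> \<lfloor>x\<rfloor>" | "int i = \<lfloor>x\<rfloor> + 1" | "\<lfloor>x\<rfloor> + 2 \<le> int i" by linarith
  then show ?thesis
  proof cases
    case 1
    then have "real i \<le> x" by linarith
    then show ?thesis using 1 by (simp add: join_prob_def)
  next
    case 2
    then have "real i = of_int \<lfloor>x\<rfloor> + 1" by linarith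
    then show ?thesis using floor unfolding join_prob_def 2 by (simp add: min_def; linarith)
  next
    case 3
    then have "x - real i + 1 \<le> 0" by linarith
    then show ?thesis using 3 by (simp add: join_prob_def)
  qed
qed

lemma join_prob_mono: "x \<le> y \<Longrightarrow> join_prob x i \<le> join_prob y i"
  by (simp add: join_prob_eq)

lemma join_prob_strict_mono:
  "x < y \<Longrightarrow> x < real i \<Longrightarrow> real i < y + 1 \<Longrightarrow> join_prob x i < join_prob y i"
  by (simp add: join_prob_eq)

lemma admissible_join_prob: "admissible (join_prob x)"
proof -
  have "\<forall>j > nat \<lceil>x\<rceil>. join_prob x j = 0"
  proof (intro allI impI)
    fix j assume "nat \<lceil>x\<rceil> < j"
    then have "x \<le> real j - 1" by linarith
    then show "join_prob x j = 0" by (simp add: join_prob_eq)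
  qed
  then show ?thesis unfolding admissible_def by (auto simp: join_prob_eq)
qed

context feedback_queue
begin

lemma solves_wait_equations_sojourn:
  "solves_wait_equations lam mu q x
     (\<lambda>i j. if (i, j) \<in> wait_indices x then sojourn (join_prob x) i j else 0)"
  (is "solves_wait_equations lam mu q x ?w")
proof -
  have "(lam + mu) * ?w i j = 1 + jump (join_prob x) ?w i j" if ij: "(i, j) \<in> wait_indices x" for i j
  proof -
    let ?W = "sojourn (join_prob x)"
    have "join_prob x (Suc j) * ?w i (Suc j) = join_prob x (Suc j) * ?W i (Suc j)"
    proof (cases "(i, Suc j) \<in> wait_indices x")
      case False
      then have "x \<le> real j" using ij unfolding wait_indices_def by simp linarith
      then show ?thesis by (simp add: join_prob_eq)
    qed simp
    moreover have "after_service q ?w i j = after_service q ?W i j"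
      using ij unfolding after_service_def by (auto simp: wait_indices_def)
    ultimately have "jump (join_prob x) ?w i j = jump (join_prob x) ?W i j"
      using ij by (simp add: jump_def)
    then show ?thesis
      using sojourn_eq[OF admissible_join_prob, of i j x] ij by (auto simp: wait_indices_def)
  qed
  then show ?thesis unfolding solves_wait_equations_def jump_def by (auto simp: add.assoc)
qed

text \<open>
  The difference of two solutions solves the homogeneous equations. As no one joins at position
  \<open>\<lceil>x\<rceil> + 2\<close>, the maximum principle applies to the index set.
\<close>

lemma solves_wait_equations_le:
  assumes v: "solves_wait_equations lam mu q x v" and w: "solves_wait_equations lam mu q x w"
    and ij: "(i, j) \<in> wait_indices x"
  shows "v i j \<le> w i j"
proof -
  define M where "M = nat (\<lceil>x\<rceil> + 1)"
  have M: "(i, j) \<in> wait_indices x \<longleftrightarrow> 1 \<le> i \<and> i \<le> j \<and> j \<le> M" for i j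
    unfolding wait_indices_def M_def by auto
  have eq: "(lam + mu) * f i j = 1 + jump (join_prob x) f i j"
    if "solves_wait_equations lam mu q x f" "1 \<le> i" "i \<le> j" "j \<le> M" for f i j
  proof -
    have "(i, j) \<in> wait_indices x" using that M by blast
    then show ?thesis
      using conjunct1[OF that(1)[unfolded solves_wait_equations_def], THEN bspec, of "(i, j)"]
      by (simp add: jump_def add.assoc)
  qed
  have "x \<le> real M" unfolding M_def by linarith
  then have "join_prob x (Suc M) = 0" by (simp add: join_prob_eq)
  then have "1 * v i j + (- 1) * w i j \<le> 0"
  proof (rule maximum_principle[OF admissible_join_prob])
    fix i j assume "1 \<le> i" "i \<le> j" "j \<le> M"
    then show "(lam + mu) * (1 * v i j + (- 1) * w i j)
        \<le> jump (join_prob x) (\<lambda>i j. 1 * v i j + (- 1) * w i j) i j"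
      using eq[OF v, of i j] eq[OF w, of i j] by (subst jump_linear) (simp add: algebra_simps)
  qed (use ij M in auto)
  then show ?thesis by simp
qed

lemma wait_eq_sojourn:
  assumes "(i, j) \<in> wait_indices x"
  shows "wait lam mu q x i j = sojourn (join_prob x) i j"
proof -
  let ?w = "\<lambda>i j. if (i, j) \<in> wait_indices x then sojourn (join_prob x) i j else 0"
  have "v = ?w" if "solves_wait_equations lam mu q x v" for v
  proof (intro ext)
    fix i j
    have "v i j = 0" if "(i, j) \<notin> wait_indices x"
      using conjunct2[OF \<open>solves_wait_equations lam mu q x v\<close>[unfolded solves_wait_equations_def]] that
      by blast
    then show "v i j = ?w i j"
      using solves_wait_equations_le[OF that solves_wait_equations_sojourn, of i j]
        solves_wait_equations_le[OF solves_wait_equations_sojourn that, of i j]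
      by (cases "(i, j) \<in> wait_indices x") simp_all
  qed
  then have "wait lam mu q x = ?w"
    unfolding wait_def using solves_wait_equations_sojourn by (intro the_equality) auto
  then show ?thesis using assms by simp
qed

text \<open>
  The time at position \<open>i\<close> upon joining, defined for all \<open>i\<close> and thus
  comparable across thresholds, whereas \<open>wait\<close> vanishes beyond position
  \<open>\<lceil>x\<rceil> + 1\<close>.
\<close>

definition diag_sojourn :: "real \<Rightarrow> nat \<Rightarrow> real" where
  "diag_sojourn x i = sojourn (join_prob x) i i"

lemma wait_eq_diag_sojourn:
  assumes "1 \<le> i" "i \<le> nat \<lceil>x\<rceil> + 1" "0 \<le> x"
  shows "wait lam mu q x i i = diag_sojourn x i"
proof -
  have "(i, i) \<in> wait_indices x" using assms unfolding wait_indices_def by (simp; linarith)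
  then show ?thesis by (simp add: diag_sojourn_def wait_eq_sojourn)
qed

lemma alpha_eq: "1 \<le> m \<Longrightarrow> alpha lam mu q m = diag_sojourn (real m) m"
  by (simp add: alpha_def wait_eq_diag_sojourn)

lemma beta_eq: "1 \<le> m \<Longrightarrow> beta lam mu q m = diag_sojourn (real m) (m + 1)"
  by (simp add: beta_def wait_eq_diag_sojourn)

lemma diag_sojourn_less: "1 \<le> i \<Longrightarrow> i < j \<Longrightarrow> diag_sojourn x i < diag_sojourn x j"
  unfolding diag_sojourn_def by (rule sojourn_diag_strict[OF admissible_join_prob])

lemma diag_sojourn_mono: "x \<le> y \<Longrightarrow> 1 \<le> i \<Longrightarrow> diag_sojourn x i \<le> diag_sojourn y i"
  unfolding diag_sojourn_def
  by (intro sojourn_mono_join admissible_join_prob join_prob_mono) auto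

lemma diag_sojourn_strict_mono:
  assumes "x < y" "2 \<le> k" "x < real k" "real k < y + 1"
  shows "diag_sojourn x k < diag_sojourn y k"
  unfolding diag_sojourn_def
  using assms
  by (intro sojourn_strict_mono_join admissible_join_prob join_prob_mono join_prob_strict_mono) auto

text \<open>
  With thresholds in \<open>[0, 1]\<close> a lone customer stays alone until her success.
\<close>

lemma diag_sojourn_first:
  assumes "0 \<le> x" "x \<le> 1"
  shows "diag_sojourn x 1 = 1 / (mu * q)"
proof -
  have "join_prob x 2 = 0" using assms by (simp add: join_prob_eq)
  then have "(lam + mu) * diag_sojourn x 1 = 1 + lam * diag_sojourn x 1 + mu * ((1 - q) * diag_sojourn x 1)"
    using sojourn_eq[OF admissible_join_prob, of 1 1 x]
    by (simp add: jump_def after_service_def diag_sojourn_def numeral_2_eq_2)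
  then have "mu * q * diag_sojourn x 1 = 1" by algebra
  then show ?thesis using mu_pos q_pos by (simp add: field_simps)
qed

text \<open>
  For thresholds in \<open>[m, m + 1]\<close> only the probability of joining at position
  \<open>m + 1\<close> varies, so the perturbation bound gives a Lipschitz estimate. This supplies
  the existence of \<open>chi\<close>.
\<close>

lemma continuous_on_diag_sojourn:
  "continuous_on {real m..real m + 1} (\<lambda>x. diag_sojourn x (m + 1))"
proof -
  define B where "B = diag_sojourn (real m + 1) (m + 1)"
  have B_pos: "0 < B"
    using sojourn_ge_step_time[OF admissible_join_prob, of "m + 1" "m + 1" "real m + 1"] lam_pos mu_pos
    unfolding B_def diag_sojourn_def
    by (smt (verit) divide_pos_pos le_add2 le_refl)
  have Lip: "\<bar>diag_sojourn y (m + 1) - diag_sojourn x (m + 1)\<bar> \<le> lam * B * B * (y - x)"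
    if xy: "real m \<le> x" "x \<le> y" "y \<le> real m + 1" for x y
  proof -
    have B: "sojourn (join_prob x) i (Suc m) \<le> B" if "1 \<le> i" "i \<le> Suc m" for i
    proof -
      have "sojourn (join_prob x) i (Suc m) \<le> sojourn (join_prob x) (Suc m) (Suc m)"
        using that(2)
      proof (induction i rule: inc_induct)
        case (step n)
        then show ?case
          using sojourn_mono_position[OF admissible_join_prob, of n "Suc m" x] that(1) by simp
      qed simp
      also have "\<dots> \<le> B"
        using diag_sojourn_mono[of x "real m + 1" "Suc m"] xy
        unfolding B_def diag_sojourn_def by simp
      finally show ?thesis .
    qed
    have "diag_sojourn y (m + 1) \<le> diag_sojourn x (m + 1)
        + (y - x) * (lam * B * diag_sojourn y (m + 1))"
      unfolding diag_sojourn_def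
    proof (rule sojourn_Lipschitz_join[OF admissible_join_prob admissible_join_prob join_prob_mono,
          where m = m])
      fix j assume "j \<noteq> Suc m"
      then have "j \<le> m \<or> m + 2 \<le> j" by auto
      then show "join_prob y j = join_prob x j" using xy by (auto simp: join_prob_eq)
    next
      show "join_prob y (Suc m) - join_prob x (Suc m) \<le> y - x"
        using xy by (simp add: join_prob_eq)
    qed (use xy B B_pos in auto)
    also have "(y - x) * (lam * B * diag_sojourn y (m + 1)) \<le> (y - x) * (lam * B * B)"
      using diag_sojourn_mono[of y "real m + 1" "m + 1"] xy lam_pos B_pos
      unfolding B_def[symmetric] by (intro mult_left_mono) auto
    finally show ?thesis
      using diag_sojourn_mono[of x y "m + 1"] xy by (simp add: algebra_simps)
  qed
  show ?thesis
    unfolding continuous_on_def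
  proof
    fix x assume x: "x \<in> {real m..real m + 1}"
    let ?F = "at x within {real m..real m + 1}"
    have "((\<lambda>y. diag_sojourn y (m + 1) - diag_sojourn x (m + 1)) \<longlongrightarrow> 0) ?F"
    proof (rule tendsto_0_le)
      show "((\<lambda>y. y - x) \<longlongrightarrow> 0) ?F" by (rule LIM_zero) (rule tendsto_ident_at)
      have "\<bar>diag_sojourn y (m + 1) - diag_sojourn x (m + 1)\<bar> \<le> \<bar>y - x\<bar> * (lam * B * B)"
        if "y \<in> {real m..real m + 1}" for y
      proof (cases "x \<le> y")
        case True
        then show ?thesis using Lip[of x y] x that by (simp add: mult.commute)
      next
        case False
        then show ?thesis
          using Lip[of y x] x that abs_minus_commute[of "diag_sojourn y (m + 1)"]
          by (simp add: mult.commute)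
      qed
      then show "\<forall>\<^sub>F y in ?F. norm (diag_sojourn y (m + 1) - diag_sojourn x (m + 1))
          \<le> norm (y - x) * (lam * B * B)"
        by (simp add: eventually_at_filter)
    qed
    then show "((\<lambda>y. diag_sojourn y (m + 1)) \<longlongrightarrow> diag_sojourn x (m + 1)) ?F"
      by (rule LIM_zero_cancel)
  qed
qed


section \<open>The stationary distribution and the payoff\<close>

text \<open>
  Positivity on the whole range \<open>0..\<lceil>x\<rceil>\<close> is all that the payoff
  comparison uses. It is read off from the product formula, which needs uniqueness: summing the
  global balance equations up to state \<open>j\<close> gives detailed balance between
  \<open>j\<close> and \<open>j + 1\<close>, and this determines the distribution.
\<close>

lemma stationary_pos:
  assumes "0 \<le> x" "j \<le> nat \<lceil>x\<rceil>"
  shows "0 < stationary lam mu q x j"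
proof -
  define N where "N = nat \<lceil>x\<rceil>"
  define b where "b = (\<lambda>j. \<Prod>k<j. birth_rate lam x k / (mu * q))"
  define Z where "Z = (\<Sum>j\<le>N. b j)"
  have N: "x \<le> real N" "\<And>j. j < N \<Longrightarrow> real j < x" unfolding N_def by linarith+
  have birth_nonneg: "0 \<le> birth_rate lam x j" for j
    using lam_pos by (simp add: birth_rate_def join_prob_eq)
  have birth_pos: "0 < birth_rate lam x j" if "j < N" for j
    using N(2)[OF that] lam_pos by (simp add: birth_rate_def join_prob_eq)
  have birth_N: "birth_rate lam x N = 0" using N by (simp add: birth_rate_def join_prob_eq)
  have b_0: "b 0 = 1" by (simp add: b_def)
  have b_Suc: "mu * q * b (Suc j) = birth_rate lam x j * b j" for j
    using mu_pos q_pos by (simp add: b_def)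
  have b_nonneg: "0 \<le> b j" for j
    unfolding b_def using birth_nonneg mu_pos q_pos by (intro prod_nonneg) auto
  have b_pos: "0 < b j" if "j \<le> N" for j
    unfolding b_def using birth_pos that mu_pos q_pos by (intro prod_pos) auto
  have b_zero: "b j = 0" if "N < j" for j
    unfolding b_def using birth_N that by (intro prod_zero) (auto intro!: bexI[of _ N])
  have Z_pos: "0 < Z" unfolding Z_def using b_pos by (intro sum_pos) auto
  have "is_stationary lam mu q x (\<lambda>j. b j / Z)"
    unfolding is_stationary_def N_def[symmetric]
  proof (intro conjI allI impI)
    show "(\<Sum>j\<le>N. b j / Z) = 1" using Z_pos by (simp add: Z_def flip: sum_divide_distrib)
    fix j
    have "(birth_rate lam x j + death_rate mu q j) * b j =
        (if j = 0 then 0 else birth_rate lam x (j - 1) * b (j - 1)) + death_rate mu q (j + 1) * b (j + 1)"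
    proof (cases j)
      case 0
      then show ?thesis using b_Suc[of 0] by (simp add: death_rate_def)
    next
      case (Suc k)
      then show ?thesis using b_Suc[of k] b_Suc[of j] by (simp add: death_rate_def distrib_right)
    qed
    then show "(birth_rate lam x j + death_rate mu q j) * (b j / Z) =
        (if j = 0 then 0 else birth_rate lam x (j - 1) * (b (j - 1) / Z))
          + death_rate mu q (j + 1) * (b (j + 1) / Z)"
      by (cases "j = 0") (simp_all add: times_divide_eq_right flip: add_divide_distrib)
  qed (use b_nonneg b_zero Z_pos in auto)
  moreover have "p = (\<lambda>j. b j / Z)" if p: "is_stationary lam mu q x p" for p
  proof -
    have balance: "(birth_rate lam x j + death_rate mu q j) * p j =
        (if j = 0 then 0 else birth_rate lam x (j - 1) * p (j - 1)) + death_rate mu q (j + 1) * p (j + 1)"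
      if "j \<le> N" for j
      using p[unfolded is_stationary_def, folded N_def, THEN conjunct2, THEN conjunct2, THEN conjunct2,
          THEN spec, THEN mp, OF that] .
    have detailed: "mu * q * p (Suc j) = birth_rate lam x j * p j" if "j \<le> N" for j
      using that
    proof (induction j)
      case 0
      then show ?case using balance[of 0] by (simp add: death_rate_def)
    next
      case (Suc j)
      then show ?case using balance[of "Suc j"] by (simp add: death_rate_def distrib_right)
    qed
    have proportional: "p j = b j * p 0" if "j \<le> N" for j
      using that
    proof (induction j)
      case (Suc j)
      then have "mu * q * p (Suc j) = mu * q * (b (Suc j) * p 0)"
        using detailed[of j] b_Suc[of j] unfolding mult.assoc[symmetric] by simp
      then show ?case using mu_pos q_pos by simp
    qed (simp add: b_0)
    have "1 = (\<Sum>j\<le>N. p j)" 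
      using p[unfolded is_stationary_def, folded N_def, THEN conjunct2, THEN conjunct2, THEN conjunct1]
      by simp
    also have "\<dots> = Z * p 0" unfolding Z_def sum_distrib_right by (intro sum.cong refl proportional) simp
    finally have "p 0 = 1 / Z" using Z_pos by (simp add: field_simps)
    moreover have "p j = 0" if "N < j" for j
      using p[unfolded is_stationary_def, folded N_def, THEN conjunct2, THEN conjunct1] that by simp
    ultimately have "p j = b j / Z" for j using proportional[of j] b_zero[of j] by (cases "j \<le> N") auto
    then show ?thesis by blast
  qed
  ultimately have "stationary lam mu q x = (\<lambda>j. b j / Z)"
    unfolding stationary_def by (rule the_equality)
  then show ?thesis using b_pos Z_pos assms by (simp add: N_def)
qed

lemma payoff_eq_sum:
  assumes "0 \<le> x" "0 \<le> y"
  shows "payoff lam mu q R0 x y =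
    (\<Sum>i = 1..nat \<lceil>y\<rceil> + 1. join_prob x i * (stationary lam mu q y (i - 1) * (R0 - diag_sojourn y i)))"
proof -
  define n where "n = nat \<lfloor>x\<rfloor>"
  define N where "N = nat \<lceil>y\<rceil> + 1"
  define f where "f = (\<lambda>i. stationary lam mu q y (i - 1) * net_payoff lam mu q R0 y i i)"
  have n: "real n = of_int \<lfloor>x\<rfloor>" unfolding n_def using assms by simp
  have join: "join_prob x i = (if i \<le> n then 1 else if i = n + 1 then x - real n else 0)" for i
  proof -
    have "int i \<le> \<lfloor>x\<rfloor> \<longleftrightarrow> i \<le> n" "int i = \<lfloor>x\<rfloor> + 1 \<longleftrightarrow> i = n + 1"
      unfolding n_def using assms(1) by linarith+
    then show ?thesis unfolding join_prob_def n by simp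
  qed
  have "(\<Sum>i = 1..N. join_prob x i * f i) =
      (\<Sum>i = 1..N. (if i \<le> n then f i else 0) + (if i = n + 1 then (x - real n) * f i else 0))"
    by (intro sum.cong) (auto simp: join)
  also have "\<dots> = (\<Sum>i = 1..N. if i \<le> n then f i else 0)
      + (\<Sum>i = 1..N. if i = n + 1 then (x - real n) * f i else 0)"
    by (rule sum.distrib)
  also have "(\<Sum>i = 1..N. if i \<le> n then f i else 0) = (\<Sum>i = 1..min n N. f i)"
    by (intro sum.mono_neutral_cong_right) auto
  also have "(\<Sum>i = 1..N. if i = n + 1 then (x - real n) * f i else 0)
      = (x - real n) * f (n + 1) * of_bool (n < N)"
    by (subst sum.delta) auto
  finally have "payoff lam mu q R0 x y = (\<Sum>i = 1..N. join_prob x i * f i)"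
    unfolding payoff_def Let_def n_def[symmetric] N_def[symmetric] by (simp add: f_def)
  also have "\<dots> = (\<Sum>i = 1..N. join_prob x i * (stationary lam mu q y (i - 1) * (R0 - diag_sojourn y i)))"
    using assms(2) unfolding f_def net_payoff_def N_def
    by (intro sum.cong) (auto simp: wait_eq_diag_sojourn)
  finally show ?thesis unfolding N_def .
qed

text \<open>
  A threshold that, at every position, shifts the probability of joining in the direction of the
  sign of the net payoff is a reply that is at least as good; by \<open>payoff_strict_mono\<close>
  it is better if the shift is effective at a position in the range of the sum.
\<close>

lemma payoff_mono:
  assumes "0 \<le> a" "0 \<le> b" "0 \<le> y"
    and "\<And>i. 1 \<le> i \<Longrightarrow> 0 \<le> (join_prob b i - join_prob a i) * (R0 - diag_sojourn y i)"
  shows "payoff lam mu q R0 a y \<le> payoff lam mu q R0 b y"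
  unfolding payoff_eq_sum[OF assms(1,3)] payoff_eq_sum[OF assms(2,3)]
proof (rule sum_mono)
  fix i assume i: "i \<in> {1..nat \<lceil>y\<rceil> + 1}"
  then have "0 < stationary lam mu q y (i - 1)" using assms(3) by (intro stationary_pos) auto
  then have "0 \<le> stationary lam mu q y (i - 1) * ((join_prob b i - join_prob a i) * (R0 - diag_sojourn y i))"
    using assms(4)[of i] i by simp
  then show "join_prob a i * (stationary lam mu q y (i - 1) * (R0 - diag_sojourn y i))
      \<le> join_prob b i * (stationary lam mu q y (i - 1) * (R0 - diag_sojourn y i))"
    by (simp add: algebra_simps)
qed

lemma payoff_strict_mono:
  assumes "0 \<le> a" "0 \<le> b" "0 \<le> y"
    and "\<And>i. 1 \<le> i \<Longrightarrow> 0 \<le> (join_prob b i - join_prob a i) * (R0 - diag_sojourn y i)"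
    and k: "1 \<le> k" "k \<le> nat \<lceil>y\<rceil> + 1" "0 < (join_prob b k - join_prob a k) * (R0 - diag_sojourn y k)"
  shows "payoff lam mu q R0 a y < payoff lam mu q R0 b y"
  unfolding payoff_eq_sum[OF assms(1,3)] payoff_eq_sum[OF assms(2,3)]
proof (rule sum_strict_mono_ex1)
  have pos: "0 < stationary lam mu q y (i - 1)" if "i \<in> {1..nat \<lceil>y\<rceil> + 1}" for i
    using assms(3) that by (intro stationary_pos) auto
  show "\<forall>i\<in>{1..nat \<lceil>y\<rceil> + 1}. join_prob a i * (stationary lam mu q y (i - 1) * (R0 - diag_sojourn y i))
      \<le> join_prob b i * (stationary lam mu q y (i - 1) * (R0 - diag_sojourn y i))"
  proof
    fix i assume i: "i \<in> {1..nat \<lceil>y\<rceil> + 1}"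
    then have "0 \<le> stationary lam mu q y (i - 1) * ((join_prob b i - join_prob a i) * (R0 - diag_sojourn y i))"
      using assms(4)[of i] pos[OF i] by simp
    then show "join_prob a i * (stationary lam mu q y (i - 1) * (R0 - diag_sojourn y i))
        \<le> join_prob b i * (stationary lam mu q y (i - 1) * (R0 - diag_sojourn y i))"
      by (simp add: algebra_simps)
  qed
  have "0 < stationary lam mu q y (k - 1) * ((join_prob b k - join_prob a k) * (R0 - diag_sojourn y k))"
    using k pos[of k] by simp
  then have "join_prob a k * (stationary lam mu q y (k - 1) * (R0 - diag_sojourn y k))
      < join_prob b k * (stationary lam mu q y (k - 1) * (R0 - diag_sojourn y k))"
    by (simp add: algebra_simps)
  then show "\<exists>i\<in>{1..nat \<lceil>y\<rceil> + 1}. join_prob a i * (stationary lam mu q y (i - 1) * (R0 - diag_sojourn y i))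
      < join_prob b i * (stationary lam mu q y (i - 1) * (R0 - diag_sojourn y i))"
    using k by (intro bexI[of _ k]) auto
qed simp


section \<open>Evolutionary stability\<close>

text \<open>
  Let \<open>k = \<lfloor>x\<rfloor> + 1\<close> be the first position at which \<open>x\<close> may
  balk and \<open>l = \<lceil>x\<rceil>\<close> the last position at which \<open>x\<close> may
  join. A larger threshold \<open>y\<close> only adds joining at positions from \<open>k\<close> on.
  If the net payoff at \<open>k\<close> is negative, \<open>y\<close> is a strictly worse reply to
  \<open>x\<close>. If it is 0 and \<open>k \<ge> 2\<close>, it becomes negative once everyone uses
  \<open>y\<close>, so that \<open>x\<close> beats \<open>y\<close> against \<open>y\<close>. A
  smaller threshold only removes joining at positions up to \<open>l\<close>, and the same argument
  applies with the signs reversed.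
\<close>

lemma is_ESS_criterion:
  assumes x: "0 \<le> x"
    and upper: "R0 < diag_sojourn x (nat \<lfloor>x\<rfloor> + 1)
      \<or> diag_sojourn x (nat \<lfloor>x\<rfloor> + 1) = R0 \<and> 1 \<le> nat \<lfloor>x\<rfloor>"
    and lower: "0 < x \<Longrightarrow> diag_sojourn x (nat \<lceil>x\<rceil>) < R0
      \<or> diag_sojourn x (nat \<lceil>x\<rceil>) = R0 \<and> 2 \<le> nat \<lceil>x\<rceil>"
  shows "is_ESS lam mu q R0 x"
proof -
  let ?U = "payoff lam mu q R0"
  have "?U y x < ?U x x \<or> ?U y x \<le> ?U x x \<and> ?U y y < ?U x y" if y: "0 \<le> y" "y \<noteq> x" for y
  proof (cases "x < y")
    case True
    define k where "k = nat \<lfloor>x\<rfloor> + 1"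
    have k: "1 \<le> k" "x < real k" "real k < y + 1" "real k \<le> x + 1" "k \<le> nat \<lceil>x\<rceil> + 1" "k \<le> nat \<lceil>y\<rceil> + 1"
      unfolding k_def using x True by linarith+
    have same: "join_prob x i = join_prob y i" if "i < k" for i
      using that k True by (simp add: join_prob_eq)
    have diff: "join_prob x i \<le> join_prob y i" for i using True by (simp add: join_prob_mono)
    have diff_k: "join_prob x k < join_prob y k" using k True by (simp add: join_prob_strict_mono)
    have sign: "0 \<le> (join_prob x i - join_prob y i) * (R0 - diag_sojourn t i)"
      if "R0 \<le> diag_sojourn t k" for t i
    proof (cases "i < k")
      case False
      then have "diag_sojourn t k \<le> diag_sojourn t i"
        using diag_sojourn_less[of k i t] k by (cases "i = k") auto
      then show ?thesis using that diff[of i] by (intro mult_nonpos_nonpos) auto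
    qed (simp add: same)
    have sign_k: "0 < (join_prob x k - join_prob y k) * (R0 - diag_sojourn t k)"
      if "R0 < diag_sojourn t k" for t
      using that diff_k by (intro mult_neg_neg) auto
    show ?thesis
    proof (cases "R0 < diag_sojourn x k")
      case True
      have "?U y x < ?U x x"
        by (rule payoff_strict_mono[OF y(1) x x sign[OF less_imp_le[OF True]] k(1,5) sign_k[OF True]])
      then show ?thesis by simp
    next
      case False
      then have eq: "diag_sojourn x k = R0" "2 \<le> k" using upper unfolding k_def by auto
      then have less: "R0 < diag_sojourn y k"
        using diag_sojourn_strict_mono[of x y k] \<open>x < y\<close> k by simp
      have "?U y y < ?U x y"
        by (rule payoff_strict_mono[OF y(1) x y(1) sign[OF less_imp_le[OF less]] k(1,6) sign_k[OF less]])
      moreover have "?U y x \<le> ?U x x" by (rule payoff_mono[OF y(1) x x sign]) (simp add: eq)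
      ultimately show ?thesis by simp
    qed
  next
    case False
    then have less: "y < x" using y by simp
    define l where "l = nat \<lceil>x\<rceil>"
    have l: "1 \<le> l" "x \<le> real l" "real l < x + 1" "l \<le> nat \<lceil>x\<rceil> + 1" "y < real l"
      unfolding l_def using y less by linarith+
    \<comment> \<open>Position \<open>l\<close> may lie outside the range of the payoff against \<open>y\<close>. The first position at
      which \<open>x\<close> and \<open>y\<close> differ lies inside.\<close>
    define k where "k = nat \<lfloor>y\<rfloor> + 1"
    have k: "1 \<le> k" "k \<le> l" "y < real k" "real k < x + 1" "k \<le> nat \<lceil>y\<rceil> + 1"
      unfolding k_def l_def using y less by linarith+
    have same: "join_prob x i = join_prob y i" if "l < i" for i
      using that l less by (simp add: join_prob_eq)
    have diff: "join_prob y i \<le> join_prob x i" for i using less by (simp add: join_prob_mono)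
    have diff_l: "join_prob y l < join_prob x l" using l less by (simp add: join_prob_strict_mono)
    have diff_k: "join_prob y k < join_prob x k" using k less by (simp add: join_prob_strict_mono)
    have diagonal: "diag_sojourn t i \<le> diag_sojourn t l" if "1 \<le> i" "i \<le> l" for t i
      using that diag_sojourn_less[of i l t] by (cases "i = l") auto
    have sign: "0 \<le> (join_prob x i - join_prob y i) * (R0 - diag_sojourn t i)"
      if "diag_sojourn t l \<le> R0" "1 \<le> i" for t i
    proof (cases "l < i")
      case False
      then show ?thesis using that diff[of i] diagonal[of i t] by (intro mult_nonneg_nonneg) auto
    qed (simp add: same)
    show ?thesis
    proof (cases "diag_sojourn x l < R0")
      case True
      then have "0 < (join_prob x l - join_prob y l) * (R0 - diag_sojourn x l)" using diff_l by simp
      then have "?U y x < ?U x x"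
        by - (rule payoff_strict_mono[OF y(1) x x sign[OF less_imp_le[OF True]] l(1,4)])
      then show ?thesis by simp
    next
      case False
      then have eq: "diag_sojourn x l = R0" "2 \<le> l" using lower x y less unfolding l_def by auto
      then have less_R0: "diag_sojourn y l < R0"
        using diag_sojourn_strict_mono[of y x l] less l by simp
      then have "0 < (join_prob x k - join_prob y k) * (R0 - diag_sojourn y k)"
        using diff_k diagonal[of k y] k by simp
      then have "?U y y < ?U x y"
        by - (rule payoff_strict_mono[OF y(1) x y(1) sign[OF less_imp_le[OF less_R0]] k(1,5)])
      moreover have "?U y x \<le> ?U x x" by (rule payoff_mono[OF y(1) x x sign]) (simp_all add: eq)
      ultimately show ?thesis by simp
    qed
  qed
  then have stable: "?U y x < ?U x x \<or> ?U x x = ?U y x \<and> ?U y y < ?U x y" if "0 \<le> y" "y \<noteq> x" for y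
    using that by (metis order_le_less)
  have "?U y x \<le> ?U x x" if "0 \<le> y" for y
    using stable[of y] that by (cases "y = x") auto
  with stable x show ?thesis unfolding is_ESS_def is_Nash_def by blast
qed

lemma alpha_less_beta: "1 \<le> m \<Longrightarrow> alpha lam mu q m < beta lam mu q m"
  by (simp add: alpha_eq beta_eq diag_sojourn_less)

lemma beta_less_alpha: "1 \<le> m \<Longrightarrow> beta lam mu q m < alpha lam mu q (m + 1)"
  using alpha_eq[of "m + 1"] beta_eq[of m]
    diag_sojourn_strict_mono[of "real m" "real (m + 1)" "m + 1"] by simp

lemma alpha_strict_mono: "1 \<le> m \<Longrightarrow> m < n \<Longrightarrow> alpha lam mu q m < alpha lam mu q n"
  using diag_sojourn_less[of m n "real n"] diag_sojourn_mono[of "real m" "real n" m]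
  by (simp add: alpha_eq)

text \<open>
  The values \<open>alpha m\<close> are unbounded because position \<open>m\<close> requires
  \<open>m\<close> services.
\<close>

lemma alpha_bracket:
  assumes "alpha lam mu q 1 \<le> R0"
  obtains m where "1 \<le> m" "alpha lam mu q m \<le> R0" "R0 < alpha lam mu q (m + 1)"
proof -
  obtain n :: nat where n: "R0 * mu + 1 < real n" using reals_Archimedean2 by blast
  have n_le: "real (Suc n) / mu \<le> alpha lam mu q (Suc n) + 1 / mu"
    using sojourn_diag_lower_bound[OF admissible_join_prob, of "Suc n"] alpha_eq[of "Suc n"]
    unfolding diag_sojourn_def by simp
  have "R0 < real n / mu" using n mu_pos by (simp add: field_simps)
  also have "\<dots> \<le> alpha lam mu q (Suc n)" using n_le by (simp add: add_divide_distrib)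
  finally have ex: "R0 < alpha lam mu q (Suc n)" .
  define m where "m = (LEAST m. R0 < alpha lam mu q (Suc m))"
  have above: "R0 < alpha lam mu q (Suc m)" unfolding m_def using ex by (rule LeastI)
  then have "1 \<le> m" using assms by (cases m) auto
  moreover have "\<not> R0 < alpha lam mu q (Suc (m - 1))"
    using not_less_Least[of "m - 1" "\<lambda>m. R0 < alpha lam mu q (Suc m)"] \<open>1 \<le> m\<close>
    unfolding m_def[symmetric] by simp
  ultimately show thesis using that[of m] above by simp
qed

lemma alpha_bracket_unique:
  assumes "1 \<le> m" "alpha lam mu q m \<le> R0" "R0 < alpha lam mu q (m + 1)"
    and "1 \<le> n" "alpha lam mu q n \<le> R0" "R0 < alpha lam mu q (n + 1)"
  shows "m = n"
proof (rule ccontr)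
  assume "m \<noteq> n"
  then have "m + 1 \<le> n \<or> n + 1 \<le> m" by auto
  then have "alpha lam mu q (m + 1) \<le> alpha lam mu q n \<or> alpha lam mu q (n + 1) \<le> alpha lam mu q m"
    using alpha_strict_mono[of "m + 1" n] alpha_strict_mono[of "n + 1" m]
    by (metis le_add2 le_neq_implies_less less_imp_le order_refl)
  then show False using assms by linarith
qed

lemma chi_properties:
  assumes m: "1 \<le> m" and R0: "beta lam mu q m < R0" "R0 < alpha lam mu q (m + 1)"
  shows "real m < chi lam mu q R0 m" "chi lam mu q R0 m < real (m + 1)"
    "diag_sojourn (chi lam mu q R0 m) (m + 1) = R0"
proof -
  let ?f = "\<lambda>x. diag_sojourn x (m + 1)"
  have ends: "?f (real m) < R0" "R0 < ?f (real m + 1)"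
    using R0 m alpha_eq[of "m + 1"] beta_eq[of m] by (auto simp: add.commute)
  then obtain x where x: "real m \<le> x" "x \<le> real m + 1" "?f x = R0"
    using IVT'[of ?f "real m" R0 "real m + 1"] continuous_on_diag_sojourn by auto
  have strict: "real m < x" "x < real m + 1"
    using x ends by (metis less_le less_irrefl)+
  have wait: "wait lam mu q y (m + 1) (m + 1) = ?f y" if "real m < y" for y
    using that by (intro wait_eq_diag_sojourn) linarith+
  have "chi lam mu q R0 m = x"
    unfolding chi_def
  proof (rule the_equality)
    show "real m < x \<and> x < real (m + 1) \<and> wait lam mu q x (m + 1) (m + 1) = R0"
      using x strict wait[of x] by simp
    fix y assume y: "real m < y \<and> y < real (m + 1) \<and> wait lam mu q y (m + 1) (m + 1) = R0"
    then have "?f y = ?f x" using wait[of y] x by simp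
    then show "y = x"
      using diag_sojourn_strict_mono[of x y "m + 1"] diag_sojourn_strict_mono[of y x "m + 1"] strict y m
      by (cases x y rule: linorder_cases) auto
  qed
  then show "real m < chi lam mu q R0 m" "chi lam mu q R0 m < real (m + 1)" "?f (chi lam mu q R0 m) = R0"
    using x strict by simp_all
qed

text \<open>
  The condition in the definite description of \<open>threshold_e\<close>.
\<close>

definition threshold_case :: "real \<Rightarrow> real \<Rightarrow> bool" where
  "threshold_case R0 x \<longleftrightarrow>
     (R0 < alpha lam mu q 1 \<and> x = 0) \<or>
     (\<exists>m \<ge> 1. alpha lam mu q m \<le> R0 \<and> R0 \<le> beta lam mu q m \<and> x = real m) \<or>
     (\<exists>m \<ge> 1. beta lam mu q m < R0 \<and> R0 < alpha lam mu q (m + 1) \<and> x = chi lam mu q R0 m)"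

text \<open>
  By \<open>alpha m < beta m < alpha (m + 1)\<close>, each case with index \<open>m\<close> forces
  \<open>alpha m \<le> R0 < alpha (m + 1)\<close>, which determines \<open>m\<close>.
\<close>

lemma threshold_case_threshold_e: "threshold_case R0 (threshold_e lam mu q R0)"
proof -
  let ?t = "\<lambda>m. if R0 \<le> beta lam mu q m then real m else chi lam mu q R0 m"
  have cases: "R0 < alpha lam mu q 1 \<and> x = 0 \<or>
      (\<exists>m \<ge> 1. alpha lam mu q m \<le> R0 \<and> R0 < alpha lam mu q (m + 1) \<and> x = ?t m)"
    if "threshold_case R0 x" for x
    using that unfolding threshold_case_def
  proof (elim disjE exE conjE)
    fix m assume "1 \<le> m" "alpha lam mu q m \<le> R0" "R0 \<le> beta lam mu q m" "x = real m"
    then show ?thesis using beta_less_alpha[of m] by (intro disjI2 exI[of _ m]) simp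
  next
    fix m assume "1 \<le> m" "beta lam mu q m < R0" "R0 < alpha lam mu q (m + 1)" "x = chi lam mu q R0 m"
    then show ?thesis using alpha_less_beta[of m] by (intro disjI2 exI[of _ m]) simp
  qed simp
  have disjoint: False if "R0 < alpha lam mu q 1" "1 \<le> m" "alpha lam mu q m \<le> R0" for m
    using alpha_strict_mono[of 1 m] that by (cases "m = 1") simp_all
  have unique: "x = y" if "threshold_case R0 x" "threshold_case R0 y" for x y
    using cases[OF that(1)] cases[OF that(2)]
  proof (elim disjE exE conjE)
    fix m n
    assume m: "1 \<le> m" "alpha lam mu q m \<le> R0" "R0 < alpha lam mu q (m + 1)" and x: "x = ?t m"
      and n: "1 \<le> n" "alpha lam mu q n \<le> R0" "R0 < alpha lam mu q (n + 1)" and y: "y = ?t n"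
    have "m = n" by (rule alpha_bracket_unique[OF m n])
    then show "x = y" unfolding x y by (rule arg_cong)
  qed (blast dest: disjoint | simp)+
  have "\<exists>x. threshold_case R0 x"
  proof (cases "R0 < alpha lam mu q 1")
    case True
    then show ?thesis unfolding threshold_case_def by blast
  next
    case False
    then have "alpha lam mu q 1 \<le> R0" by simp
    then obtain m where "1 \<le> m" "alpha lam mu q m \<le> R0" "R0 < alpha lam mu q (m + 1)"
      by (rule alpha_bracket)
    then have "threshold_case R0 (?t m)" unfolding threshold_case_def by (auto simp: not_le)
    then show ?thesis ..
  qed
  then have "\<exists>!x. threshold_case R0 x" using unique by blast
  then show ?thesis
    unfolding threshold_e_def threshold_case_def by (rule theI')
qed

text \<open>
  In the case \<open>x = m\<close> the criterion involves \<open>beta m\<close> at position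
  \<open>m + 1 \<ge> 2\<close> and \<open>alpha m\<close> at position \<open>m\<close>; only
  \<open>R0 = alpha 1\<close> would violate it. In the case \<open>x = chi m\<close> the two
  positions of the criterion coincide, and the customer is indifferent there.
\<close>

lemma is_ESS_threshold_case:
  assumes "threshold_case R0 x" "R0 \<noteq> alpha lam mu q 1"
  shows "is_ESS lam mu q R0 x"
  using assms(1) unfolding threshold_case_def
proof (elim disjE conjE exE)
  assume "R0 < alpha lam mu q 1" "x = 0"
  then show ?thesis
    using alpha_eq[of 1] diag_sojourn_first[of 0] diag_sojourn_first[of 1]
    by (intro is_ESS_criterion) auto
next
  fix m assume m: "1 \<le> m" "alpha lam mu q m \<le> R0" "R0 \<le> beta lam mu q m" "x = real m"
  show ?thesis
  proof (rule is_ESS_criterion)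
    show "R0 < diag_sojourn x (nat \<lfloor>x\<rfloor> + 1) \<or>
        diag_sojourn x (nat \<lfloor>x\<rfloor> + 1) = R0 \<and> 1 \<le> nat \<lfloor>x\<rfloor>"
      using m beta_eq[of m] by auto
    show "diag_sojourn x (nat \<lceil>x\<rceil>) < R0 \<or> diag_sojourn x (nat \<lceil>x\<rceil>) = R0 \<and> 2 \<le> nat \<lceil>x\<rceil>"
      using m alpha_eq[of m] assms(2) by (cases "m = 1") auto
  qed (use m in simp)
next
  fix m assume m: "1 \<le> m" "beta lam mu q m < R0" "R0 < alpha lam mu q (m + 1)"
    and x: "x = chi lam mu q R0 m"
  note chi = chi_properties[OF m, folded x]
  have floor: "nat \<lfloor>x\<rfloor> = m" "nat \<lceil>x\<rceil> = m + 1" using chi(1,2) by linarith+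
  show ?thesis
    using chi m by (intro is_ESS_criterion) (auto simp: floor)
qed

end

theorem corollary3p1:
  fixes lam mu q R0 :: real
  assumes "lam > 0" and "mu > 0" and "0 < q" and "q < 1" and "R0 > 0"
    and "R0 \<noteq> alpha lam mu q 1"
  shows "is_ESS lam mu q R0 (threshold_e lam mu q R0)"
proof -
  interpret feedback_queue lam mu q using assms by unfold_locales
  show ?thesis using is_ESS_threshold_case threshold_case_threshold_e assms by blast
qed

end
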